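(* The graph $T_7$ is a minimal non-word-representable graph: $T_7$ is not word-representable, but every graph obtained from $T_7$ by deleting one vertex is word-representable.
   Context: A graph $G=(V,E)$ is word-representable if there exists a word $w$ over the alphabet $V$ such that for all distinct $x,y\in V$, the letters $x$ and $y$ alternate in $w$ if and only if $xy\in E$ (alternation meaning that deleting all letters other than $x$ and $y$ leaves $xyxy\cdots$ or $yxyx\cdots$). The graph $T_7$ has vertex set $\{1,\dots,9\}$; the vertices $1,2,3,4,5$ form a clique, the vertices $6,7,8,9$ form an independent set, and the remaining edges are: $6$ is adjacent to $1,3$; $7$ is adjacent to $2,4$; $8$ is adjacent to $1,2,5$; $9$ is adjacent to $3,4,5$. *)

theory Defs
  imports Main
begin

definition alternate :: "'a list \<Rightarrow> 'a \<Rightarrow> 'a \<Rightarrow> bool" where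
  "alternate w x y \<longleftrightarrow>
     (let u = filter (\<lambda>z. z = x \<or> z = y) w in \<forall>i. Suc i < length u \<longrightarrow> u ! i \<noteq> u ! Suc i)"

definition word_representable :: "'a set \<Rightarrow> ('a \<Rightarrow> 'a \<Rightarrow> bool) \<Rightarrow> bool" where
  "word_representable V E \<longleftrightarrow>
     (\<exists>w. set w = V \<and> (\<forall>x\<in>V. \<forall>y\<in>V. x \<noteq> y \<longrightarrow> (alternate w x y \<longleftrightarrow> E x y)))"

definition T7_V :: "nat set" where
  "T7_V = {1..9}"

definition T7_E :: "nat \<Rightarrow> nat \<Rightarrow> bool" where
  "T7_E x y \<longleftrightarrow> x \<noteq> y \<and>
     ((x \<in> {1..5} \<and> y \<in> {1..5}) \<or>
      {x, y} \<in> {{6,1},{6,3},{7,2},{7,4},{8,1},{8,2},{8,5},{9,3},{9,4},{9,5}})"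

end

theory Submission
  imports Defs
begin

text \<open>
  Two letters alternate in a word iff, for one of the two orders \<open>x, y\<close>, every prefix contains as
  many \<open>x\<close> as \<open>y\<close> or exactly one more. Orienting the edges of a represented graph accordingly gives
  a semi-transitive orientation, and on a clique it is a linear order. If four clique vertices
  occur in the order \<open>p, q, r, s\<close>, no vertex can be adjacent to \<open>p, r\<close> but not to \<open>q, s\<close>, or
  to \<open>q, s\<close> but not to \<open>p, r\<close>: the neighbourhood of a vertex outside the clique is an interval
  of the cyclic order of the clique. In \<open>T\<^sub>7\<close>, the neighbourhoods of \<open>6, 7, 8, 9\<close> (or their
  complements in the clique) would force \<open>{1,3}\<close>, \<open>{2,4}\<close>, \<open>{3,4}\<close>, \<open>{1,2}\<close> to be pairs of
  neighbours in a cyclic order of five elements, which would thus contain a 4-cycle.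
\<close>

section \<open>Alternation through prefix counts\<close>

definition dominates :: "'a list \<Rightarrow> 'a \<Rightarrow> 'a \<Rightarrow> bool" where
  "dominates w x y \<longleftrightarrow> (\<forall>n. count_list (take n w) y \<le> count_list (take n w) x)"

text \<open>\<open>dominates\<close> is kept separate because it is transitive. The upper bound
  added here is not: along two steps the counts may drift apart by two.\<close>

definition leads :: "'a list \<Rightarrow> 'a \<Rightarrow> 'a \<Rightarrow> bool" where
  "leads w x y \<longleftrightarrow> dominates w x y \<and> (\<forall>n. count_list (take n w) x \<le> Suc (count_list (take n w) y))"

lemma all_nat_split: "(\<forall>n. P n) \<longleftrightarrow> P 0 \<and> (\<forall>n. P (Suc n))"
  by (metis not0_implies_Suc)

lemma leads_Nil: "leads [] x y"
  by (simp add: leads_def dominates_def)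

text \<open>An initial \<open>x\<close> puts \<open>x\<close> one ahead, so on the rest of the word
  \<open>y\<close> has to lead; an initial \<open>y\<close> breaks domination at once.\<close>

lemma leads_Cons:
  assumes "x \<noteq> y"
  shows "leads (z # w) x y \<longleftrightarrow> (if z = x then leads w y x else z \<noteq> y \<and> leads w x y)"
proof -
  have "\<exists>n. \<not> Suc (count_list (take n w) y) \<le> count_list (take n w) x"
    by (rule exI[of _ 0]) simp
  then show ?thesis
    unfolding leads_def dominates_def
    by (subst (1 2) all_nat_split) (use assms in auto)
qed

lemma alternate_iff_distinct_adj:
  "alternate w x y \<longleftrightarrow> distinct_adj (filter (\<lambda>z. z = x \<or> z = y) w)"
  unfolding alternate_def Let_def distinct_adj_conv_nth by (metis less_diff_conv add.commute plus_1_eq_Suc)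

text \<open>The letter that occurs first fixes the direction; if neither occurs, both directions
  hold. The induction generalizes both letters, since an initial \<open>x\<close> exchanges their
  roles.\<close>

lemma leads_iff:
  assumes "x \<noteq> y"
  shows "leads w x y \<longleftrightarrow> alternate w x y \<and>
    (let u = filter (\<lambda>z. z = x \<or> z = y) w in u = [] \<or> hd u = x)"
  using assms
proof (induction w arbitrary: x y)
  case Nil
  then show ?case by (simp add: leads_Nil alternate_iff_distinct_adj)
next
  case (Cons z w)
  have swap: "filter (\<lambda>z. z = y \<or> z = x) w = filter (\<lambda>z. z = x \<or> z = y) w"
    by (rule filter_cong) auto
  have "set (filter (\<lambda>z. z = x \<or> z = y) w) \<subseteq> {x, y}"
    by auto
  then have hd: "hd (filter (\<lambda>z. z = x \<or> z = y) w) \<in> {x, y}" if "filter (\<lambda>z. z = x \<or> z = y) w \<noteq> []"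
    using that hd_in_set by blast
  show ?case
    using Cons.prems Cons.IH[of x y] Cons.IH[of y x] hd
    by (auto simp: leads_Cons alternate_iff_distinct_adj swap distinct_adj_Cons Let_def)
qed

lemma alternate_commute: "alternate w x y \<longleftrightarrow> alternate w y x"
  by (simp add: alternate_def disj_commute)

lemma alternate_iff_leads:
  assumes "x \<noteq> y"
  shows "alternate w x y \<longleftrightarrow> leads w x y \<or> leads w y x"
proof -
  let ?u = "filter (\<lambda>z. z = x \<or> z = y) w"
  have swap: "filter (\<lambda>z. z = y \<or> z = x) w = ?u"
    by (rule filter_cong) auto
  have "set ?u \<subseteq> {x, y}"
    by auto
  then have "?u = [] \<or> hd ?u = x \<or> hd ?u = y"
    using hd_in_set by blast
  then show ?thesis
    using assms by (auto simp: leads_iff swap alternate_commute[of w y x] Let_def)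
qed

section \<open>Domination as an order, shortcuts and crossings\<close>

lemma dominates_refl: "dominates w x x"
  by (simp add: dominates_def)

lemma dominates_trans: "dominates w x y \<Longrightarrow> dominates w y z \<Longrightarrow> dominates w x z"
  unfolding dominates_def using le_trans by blast

lemma leads_imp_dominates: "leads w x y \<Longrightarrow> dominates w x y"
  by (simp add: leads_def)

text \<open>Mutual domination makes all prefix counts agree, so each letter leads the other. The
  restricted word, nonempty because \<open>x\<close> occurs, would then begin with both.\<close>

lemma dominates_antisym:
  assumes "dominates w x y" "dominates w y x" "x \<in> set w"
  shows "x = y"
proof (rule ccontr)
  assume "x \<noteq> y"
  from assms have "leads w x y" "leads w y x"
    by (auto simp: leads_def dominates_def intro: le_SucI)
  moreover have "filter (\<lambda>z. z = x \<or> z = y) w \<noteq> []"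
    using \<open>x \<in> set w\<close> by (auto simp: filter_empty_conv)
  moreover have "filter (\<lambda>z. z = y \<or> z = x) w = filter (\<lambda>z. z = x \<or> z = y) w"
    by (rule filter_cong) auto
  ultimately show False
    using \<open>x \<noteq> y\<close> by (auto simp: leads_iff Let_def)
qed

text \<open>This is semi-transitivity: in every prefix the counts weakly decrease from
  \<open>a\<close> through \<open>b\<close> and \<open>c\<close> to \<open>d\<close>, so the gap
  between \<open>b\<close> and \<open>c\<close> is at most the gap between \<open>a\<close> and
  \<open>d\<close>, hence at most one.\<close>

lemma leads_shortcut:
  assumes "leads w a d" "dominates w a b" "dominates w b c" "dominates w c d"
  shows "leads w b c"
  unfolding leads_def
proof (intro conjI allI)
  fix n
  have "count_list (take n w) b \<le> count_list (take n w) a"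
    "count_list (take n w) a \<le> Suc (count_list (take n w) d)"
    "count_list (take n w) d \<le> count_list (take n w) c"
    using assms by (auto simp: leads_def dominates_def)
  then show "count_list (take n w) b \<le> Suc (count_list (take n w) c)"
    by linarith
qed fact

lemma no_crossing:
  assumes lead: "leads w p q" "leads w q r" "leads w r s" "leads w p s"
    and inw: "p \<in> set w" "q \<in> set w"
    and neq: "p \<noteq> r" "q \<noteq> s" "x \<notin> {p, q, r, s}"
  shows "\<not> (alternate w x p \<and> alternate w x r \<and> \<not> alternate w x q \<and> \<not> alternate w x s)"
    and "\<not> (alternate w x q \<and> alternate w x s \<and> \<not> alternate w x p \<and> \<not> alternate w x r)"
proof -
  have alt: "alternate w x y \<longleftrightarrow> leads w x y \<or> leads w y x" if "y \<in> {p, q, r, s}" for y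
    using that neq by (intro alternate_iff_leads) auto
  note dom = lead[THEN leads_imp_dominates]
  have dom2: "dominates w p r" "dominates w q s"
    using dominates_trans[OF dom(1,2)] dominates_trans[OF dom(2,3)] .
  show "\<not> (alternate w x p \<and> alternate w x r \<and> \<not> alternate w x q \<and> \<not> alternate w x s)"
  proof
    assume *: "alternate w x p \<and> alternate w x r \<and> \<not> alternate w x q \<and> \<not> alternate w x s"
    then have non: "\<not> leads w x q" "\<not> leads w q x" "\<not> leads w x s"
      using alt by auto
    \<comment> \<open>If \<open>x\<close> comes before or after both \<open>p\<close> and
      \<open>r\<close>, its longer edge spans \<open>q\<close>; if \<open>x\<close> lies between
      them, the edge from \<open>p\<close> to \<open>s\<close> spans \<open>x\<close>. Either way a
      shortcut joins \<open>x\<close> to a non-neighbour. The last case closes a directed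
      cycle.\<close>
    from * alt consider "leads w x p" "leads w x r" | "leads w p x" "leads w r x"
      | "leads w p x" "leads w x r" | "leads w x p" "leads w r x"
      by auto
    then show False
    proof cases
      case 1
      then show False
        using leads_shortcut[of w x r x q] dom non dominates_refl dominates_trans leads_imp_dominates
        by metis
    next
      case 2
      then show False
        using leads_shortcut[of w p x q x] dom non dominates_refl dominates_trans leads_imp_dominates
        by metis
    next
      case 3
      then show False
        using leads_shortcut[of w p s x s] lead dom non dominates_refl dominates_trans leads_imp_dominates
        by metis
    next
      case 4
      then have "dominates w r p"
        using dominates_trans leads_imp_dominates by metis
      then show False
        using dominates_antisym[of w p r] dom2 inw neq by auto
    qed
  qed
  show "\<not> (alternate w x q \<and> alternate w x s \<and> \<not> alternate w x p \<and> \<not> alternate w x r)"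
  proof
    assume *: "alternate w x q \<and> alternate w x s \<and> \<not> alternate w x p \<and> \<not> alternate w x r"
    then have non: "\<not> leads w x r" "\<not> leads w r x" "\<not> leads w p x"
      using alt by auto
    \<comment> \<open>The same split: now the longer edge spans \<open>r\<close>, and an
      \<open>x\<close> between \<open>q\<close> and \<open>s\<close> receives an edge from
      \<open>p\<close>.\<close>
    from * alt consider "leads w x q" "leads w x s" | "leads w q x" "leads w s x"
      | "leads w q x" "leads w x s" | "leads w x q" "leads w s x"
      by auto
    then show False
    proof cases
      case 1
      then show False
        using leads_shortcut[of w x s x r] dom non dominates_refl dominates_trans leads_imp_dominates
        by metis
    next
      case 2
      then show False
        using leads_shortcut[of w q x r x] dom non dominates_refl dominates_trans leads_imp_dominates
        by metis
    next
      case 3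
      then show False
        using leads_shortcut[of w p s p x] lead dom non dominates_refl dominates_trans leads_imp_dominates
        by metis
    next
      case 4
      then have "dominates w s q"
        using dominates_trans leads_imp_dominates by metis
      then show False
        using dominates_antisym[of w q s] dom2 inw neq by auto
    qed
  qed
qed

text \<open>An edge from \<open>z\<close> back to \<open>x\<close> would make \<open>x\<close> and
  \<open>z\<close> dominate each other.\<close>

lemma leads_trans:
  assumes "leads w x y" "leads w y z" "alternate w x z" "x \<noteq> z" "x \<in> set w"
  shows "leads w x z"
proof (rule ccontr)
  assume "\<not> leads w x z"
  then have "leads w z x"
    using assms by (simp add: alternate_iff_leads)
  moreover have "dominates w x z"
    using assms(1,2)[THEN leads_imp_dominates] by (rule dominates_trans)
  ultimately show False
    using assms dominates_antisym leads_imp_dominates by fast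
qed

section \<open>The cyclic order of the clique in \<open>T7\<close>\<close>

lemma T7_not_word_representable: "\<not> word_representable T7_V T7_E"
proof
  assume "word_representable T7_V T7_E"
  then obtain w where w: "set w = {1..9::nat}"
    and alt: "\<And>x y. x \<in> {1..9} \<Longrightarrow> y \<in> {1..9} \<Longrightarrow> x \<noteq> y \<Longrightarrow> alternate w x y \<longleftrightarrow> T7_E x y"
    unfolding word_representable_def T7_V_def by auto
  let ?K = "{1..5::nat}"
  let ?L = "leads w"
  have adj: "alternate w x y" if "x \<in> ?K" "y \<in> ?K" "x \<noteq> y" for x y
    using that alt[of x y] by (auto simp: T7_E_def)
  have total: "?L x y \<or> ?L y x" if "x \<in> ?K" "y \<in> ?K" "x \<noteq> y" for x y
    using that adj[of x y] alternate_iff_leads[of x y w] by simp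
  \<comment> \<open>With \<open>acyclic\<close>, this makes the clique a tournament without cyclic
    triangles, hence linearly ordered.\<close>
  have flip: "?L y x \<longleftrightarrow> \<not> ?L x y" if "x \<in> ?K" "y \<in> ?K" "x \<noteq> y" for x y
    using that total[of x y] dominates_antisym[of w x y] leads_imp_dominates[of w x y]
      leads_imp_dominates[of w y x] w by auto
  have acyclic: "\<not> (?L x y \<and> ?L y z \<and> ?L z x)"
    if "x \<in> ?K" "y \<in> ?K" "z \<in> ?K" "x \<noteq> z" for x y z
    using that leads_trans[of w x y z] adj[of x z] flip[of x z] w by auto
  have cross: "\<not> (?L p q \<and> ?L q r \<and> ?L r s \<and> ?L p s)"
    if "T7_E x p \<and> T7_E x r \<and> \<not> T7_E x q \<and> \<not> T7_E x s \<or>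
        T7_E x q \<and> T7_E x s \<and> \<not> T7_E x p \<and> \<not> T7_E x r"
      "x \<in> {6..9}" "{p, q, r, s} \<subseteq> ?K" "p \<noteq> r" "q \<noteq> s" for x p q r s
  proof
    assume "?L p q \<and> ?L q r \<and> ?L r s \<and> ?L p s"
    then have "?L p q" "?L q r" "?L r s" "?L p s"
      by auto
    from no_crossing[OF this, of x] show False
      using that w by (auto simp: alt)
  qed
  \<comment> \<open>\<open>?L a c = ?L b c\<close> says that \<open>c\<close> is not between
    \<open>a\<close> and \<open>b\<close>. So the claim is that two neighbours of \<open>x\<close>
    do not separate two of its non-neighbours in the cyclic order.\<close>
  have nonsep: "(?L a c \<longleftrightarrow> ?L b c) \<longleftrightarrow> (?L a d \<longleftrightarrow> ?L b d)"
    if adj_x: "x \<in> {6..9}" "T7_E x a" "T7_E x b" "\<not> T7_E x c" "\<not> T7_E x d"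
      and K: "{a, b, c, d} \<subseteq> ?K" and ne: "a \<noteq> b" "c \<noteq> d" for x a b c d
  proof -
    have ne': "a \<noteq> c" "b \<noteq> c" "a \<noteq> d" "b \<noteq> d"
      using adj_x by auto
    \<comment> \<open>These are the eight linear orders in which the pairs \<open>a, b\<close> and
      \<open>c, d\<close> interleave.\<close>
    have "\<not> (?L a c \<and> ?L c b \<and> ?L b d \<and> ?L a d)" "\<not> (?L a d \<and> ?L d b \<and> ?L b c \<and> ?L a c)"
      "\<not> (?L b c \<and> ?L c a \<and> ?L a d \<and> ?L b d)" "\<not> (?L b d \<and> ?L d a \<and> ?L a c \<and> ?L b c)"
      "\<not> (?L c a \<and> ?L a d \<and> ?L d b \<and> ?L c b)" "\<not> (?L d a \<and> ?L a c \<and> ?L c b \<and> ?L d b)"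
      "\<not> (?L c b \<and> ?L b d \<and> ?L d a \<and> ?L c a)" "\<not> (?L d b \<and> ?L b c \<and> ?L c a \<and> ?L d a)"
      by (rule cross[of x]; use adj_x K ne in simp)+
    moreover have "?L c a \<longleftrightarrow> \<not> ?L a c" "?L c b \<longleftrightarrow> \<not> ?L b c" "?L d a \<longleftrightarrow> \<not> ?L a d" "?L d b \<longleftrightarrow> \<not> ?L b d"
      "?L b a \<longleftrightarrow> \<not> ?L a b" "?L d c \<longleftrightarrow> \<not> ?L c d"
      by (rule flip; use K ne ne' in simp)+
    moreover have "\<not> (?L a b \<and> ?L b c \<and> ?L c a)" "\<not> (?L a c \<and> ?L c b \<and> ?L b a)"
      "\<not> (?L a b \<and> ?L b d \<and> ?L d a)" "\<not> (?L a d \<and> ?L d b \<and> ?L b a)"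
      "\<not> (?L a c \<and> ?L c d \<and> ?L d a)" "\<not> (?L a d \<and> ?L d c \<and> ?L c a)"
      "\<not> (?L b c \<and> ?L c d \<and> ?L d b)" "\<not> (?L b d \<and> ?L d c \<and> ?L c b)"
      by (rule acyclic; use K ne ne' in simp)+
    ultimately show ?thesis
      by sat
  qed
  \<comment> \<open>Vertex 6 makes 1, 3 cyclic neighbours and vertex 8 makes 3, 4 so, which leaves,
    up to reversal, the cyclic orders 1, 3, 4, 2, 5 and 1, 3, 4, 5, 2. The instance for 7 excludes
    the second, the one for 9 the first.\<close>
  have "(?L 1 2 \<longleftrightarrow> ?L 3 2) \<longleftrightarrow> (?L 1 4 \<longleftrightarrow> ?L 3 4)"
    "(?L 1 4 \<longleftrightarrow> ?L 3 4) \<longleftrightarrow> (?L 1 5 \<longleftrightarrow> ?L 3 5)"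
    by (rule nonsep[of 6]; simp add: T7_E_def doubleton_eq_iff)+
  moreover have "(?L 2 1 \<longleftrightarrow> ?L 4 1) \<longleftrightarrow> (?L 2 5 \<longleftrightarrow> ?L 4 5)"
    by (rule nonsep[of 7]; simp add: T7_E_def doubleton_eq_iff)
  moreover have "(?L 1 3 \<longleftrightarrow> ?L 2 3) \<longleftrightarrow> (?L 1 4 \<longleftrightarrow> ?L 2 4)"
    "(?L 1 3 \<longleftrightarrow> ?L 5 3) \<longleftrightarrow> (?L 1 4 \<longleftrightarrow> ?L 5 4)"
    by (rule nonsep[of 8]; simp add: T7_E_def doubleton_eq_iff)+
  moreover have "(?L 3 1 \<longleftrightarrow> ?L 5 1) \<longleftrightarrow> (?L 3 2 \<longleftrightarrow> ?L 5 2)"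
    by (rule nonsep[of 9]; simp add: T7_E_def doubleton_eq_iff)
  moreover have "?L 2 1 \<longleftrightarrow> \<not> ?L 1 2" "?L 3 1 \<longleftrightarrow> \<not> ?L 1 3" "?L 4 1 \<longleftrightarrow> \<not> ?L 1 4"
    "?L 5 1 \<longleftrightarrow> \<not> ?L 1 5" "?L 3 2 \<longleftrightarrow> \<not> ?L 2 3" "?L 4 2 \<longleftrightarrow> \<not> ?L 2 4"
    "?L 5 2 \<longleftrightarrow> \<not> ?L 2 5" "?L 4 3 \<longleftrightarrow> \<not> ?L 3 4" "?L 5 3 \<longleftrightarrow> \<not> ?L 3 5"
    "?L 5 4 \<longleftrightarrow> \<not> ?L 4 5"
    by (rule flip; simp)+
  moreover have "\<not> (?L 1 2 \<and> ?L 2 3 \<and> ?L 3 1)" "\<not> (?L 1 3 \<and> ?L 3 2 \<and> ?L 2 1)"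
    "\<not> (?L 1 2 \<and> ?L 2 4 \<and> ?L 4 1)" "\<not> (?L 1 4 \<and> ?L 4 2 \<and> ?L 2 1)"
    "\<not> (?L 1 2 \<and> ?L 2 5 \<and> ?L 5 1)" "\<not> (?L 1 5 \<and> ?L 5 2 \<and> ?L 2 1)"
    "\<not> (?L 1 3 \<and> ?L 3 4 \<and> ?L 4 1)" "\<not> (?L 1 4 \<and> ?L 4 3 \<and> ?L 3 1)"
    "\<not> (?L 1 3 \<and> ?L 3 5 \<and> ?L 5 1)" "\<not> (?L 1 5 \<and> ?L 5 3 \<and> ?L 3 1)"
    "\<not> (?L 1 4 \<and> ?L 4 5 \<and> ?L 5 1)" "\<not> (?L 1 5 \<and> ?L 5 4 \<and> ?L 4 1)"
    "\<not> (?L 2 3 \<and> ?L 3 4 \<and> ?L 4 2)" "\<not> (?L 2 4 \<and> ?L 4 3 \<and> ?L 3 2)"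
    "\<not> (?L 2 3 \<and> ?L 3 5 \<and> ?L 5 2)" "\<not> (?L 2 5 \<and> ?L 5 3 \<and> ?L 3 2)"
    "\<not> (?L 2 4 \<and> ?L 4 5 \<and> ?L 5 2)" "\<not> (?L 2 5 \<and> ?L 5 4 \<and> ?L 4 2)"
    "\<not> (?L 3 4 \<and> ?L 4 5 \<and> ?L 5 3)" "\<not> (?L 3 5 \<and> ?L 5 4 \<and> ?L 4 3)"
    by (rule acyclic; simp)+
  ultimately show False
    by sat
qed

section \<open>Words for the vertex-deleted subgraphs\<close>

lemma word_representableI:
  assumes "set w = V"
    and "\<forall>x\<in>set w. \<forall>y\<in>set w. x \<noteq> y \<longrightarrow>
      (distinct_adj (filter (\<lambda>z. z = x \<or> z = y) w) \<longleftrightarrow> E x y)"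
  shows "word_representable V E"
  using assms unfolding word_representable_def alternate_iff_distinct_adj by blast

text \<open>Restricted to the remaining clique vertices, each word below is a permutation written
  twice. Its cyclic order makes the neighbourhood of every remaining outer vertex an interval, for
  example 1, 2, 4, 3, 5 once 6 is deleted. As the quantifiers range over \<open>set w\<close>,
  checking a word is a finite computation.\<close>

lemma T7_minus_vertex_word_representable:
  assumes "v \<in> T7_V"
  shows "word_representable (T7_V - {v}) T7_E"
proof -
  have V: "T7_V = {1, 2, 3, 4, 5, 6, 7, 8, 9}"
    by (auto simp: T7_V_def)
  from assms consider "v = 1" | "v = 2" | "v = 3" | "v = 4" | "v = 5" | "v = 6" | "v = 7" | "v = 8" | "v = 9"
    by (auto simp: V)
  then show ?thesis
  proof cases
    case 1
    show ?thesis
      unfolding 1 T7_V_def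
      by (intro word_representableI[of "[7, 2, 4, 6, 3, 6, 7, 8, 5, 2, 8, 9, 4, 7, 3, 5]"]; code_simp)
  next
    case 2
    show ?thesis
      unfolding 2 T7_V_def
      by (intro word_representableI[of "[1, 3, 6, 7, 4, 7, 8, 5, 1, 8, 9, 3, 4, 5, 9]"]; code_simp)
  next
    case 3
    show ?thesis
      unfolding 3 T7_V_def
      by (intro word_representableI[of "[1, 6, 7, 2, 4, 7, 8, 5, 1, 2, 8, 9, 4, 5, 9]"]; code_simp)
  next
    case 4
    show ?thesis
      unfolding 4 T7_V_def
      by (intro word_representableI[of "[1, 3, 6, 8, 5, 7, 2, 7, 1, 8, 9, 3, 5, 9, 2]"]; code_simp)
  next
    case 5
    show ?thesis
      unfolding 5 T7_V_def
      by (intro word_representableI[of "[1, 6, 7, 9, 2, 4, 7, 3, 8, 1, 2, 8, 9, 4, 6, 3, 9]"]; code_simp)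
  next
    case 6
    show ?thesis
      unfolding 6 T7_V_def
      by (intro word_representableI[of "[1, 7, 2, 4, 7, 3, 8, 5, 1, 2, 8, 9, 4, 3, 5]"]; code_simp)
  next
    case 7
    show ?thesis
      unfolding 7 T7_V_def
      by (intro word_representableI[of "[1, 2, 5, 8, 4, 6, 3, 1, 6, 2, 9, 5, 4, 3, 9]"]; code_simp)
  next
    case 8
    show ?thesis
      unfolding 8 T7_V_def
      by (intro word_representableI[of "[1, 6, 7, 9, 2, 4, 7, 5, 3, 1, 2, 9, 4, 5, 6, 3, 9]"]; code_simp)
  next
    case 9
    show ?thesis
      unfolding 9 T7_V_def
      by (intro word_representableI[of "[1, 3, 6, 4, 8, 2, 5, 1, 8, 3, 7, 4, 2, 7, 5]"]; code_simp)
  qed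
qed

theorem theorem15:
  shows "\<not> word_representable T7_V T7_E \<and>
         (\<forall>v\<in>T7_V. word_representable (T7_V - {v}) T7_E)"
  using T7_not_word_representable T7_minus_vertex_word_representable by blast

end
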